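(* Let $r$ be a positive integer, let $H$ be an $r$-degenerate bipartite graph on $h$ vertices, and let $n>h^{10}$. Then $\mathrm{ex}(n,H)<n^{2-\frac{1}{8r}}$.
   Context: A graph is $r$-degenerate if every one of its subgraphs contains a vertex of degree at most $r$. The Turán number $\mathrm{ex}(n,H)$ is the maximum number of edges in a graph on $n$ vertices that does not contain $H$ as a subgraph. *)

theory Defs
  imports Complex_Main
begin

text \<open>Finite simple graphs: a vertex set together with a set of two-element subsets of it.\<close>

type_synonym 'a graph = "'a set \<times> 'a set set"

abbreviation verts :: "'a graph \<Rightarrow> 'a set" where
  "verts \<equiv> fst"

abbreviation edges :: "'a graph \<Rightarrow> 'a set set" where
  "edges \<equiv> snd"

definition simple_graph :: "'a graph \<Rightarrow> bool" where
  "simple_graph G \<longleftrightarrow> finite (verts G) \<and> (\<forall>e\<in>edges G. e \<subseteq> verts G \<and> card e = 2)"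

definition subgraph :: "'a graph \<Rightarrow> 'a graph \<Rightarrow> bool" where
  "subgraph S G \<longleftrightarrow> simple_graph S \<and> verts S \<subseteq> verts G \<and> edges S \<subseteq> edges G"

definition degree :: "'a graph \<Rightarrow> 'a \<Rightarrow> nat" where
  "degree G v = card {e \<in> edges G. v \<in> e}"

text \<open>The subgraph without vertices has no vertex at all and must be excluded; otherwise
  no graph would be degenerate.\<close>

definition degenerate :: "nat \<Rightarrow> 'a graph \<Rightarrow> bool" where
  "degenerate r G \<longleftrightarrow>
    (\<forall>S. subgraph S G \<and> verts S \<noteq> {} \<longrightarrow> (\<exists>v\<in>verts S. degree S v \<le> r))"

definition bipartite :: "'a graph \<Rightarrow> bool" where
  "bipartite G \<longleftrightarrow>
    (\<exists>A B. A \<union> B = verts G \<and> A \<inter> B = {} \<and> (\<forall>e\<in>edges G. \<exists>a\<in>A. \<exists>b\<in>B. e = {a, b}))"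

definition isomorphic :: "'a graph \<Rightarrow> 'b graph \<Rightarrow> bool" where
  "isomorphic G G' \<longleftrightarrow>
    (\<exists>f. bij_betw f (verts G) (verts G') \<and> edges G' = (\<lambda>e. f ` e) ` edges G)"

text \<open>As usual in extremal graph theory, subgraphs are not required to be induced, and
  containing a graph means having a subgraph isomorphic to it.\<close>

definition contains_copy :: "'b graph \<Rightarrow> 'a graph \<Rightarrow> bool" where
  "contains_copy G H \<longleftrightarrow> (\<exists>S. subgraph S G \<and> isomorphic H S)"

definition turan_edge_counts :: "nat \<Rightarrow> 'a graph \<Rightarrow> nat set" where
  "turan_edge_counts n H =
    {card (edges G) | G :: nat graph.
       simple_graph G \<and> card (verts G) = n \<and> \<not> contains_copy G H}"

text \<open>The Turan number. Vertices are taken from the naturals; by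
  \<open>card_edges_le_turan\<close> below this is no restriction. The set of edge counts is finite, so
  \<^term>\<open>Sup\<close> is its maximum whenever it is nonempty. It is empty iff every graph on \<open>n\<close>
  vertices contains \<open>H\<close> (\<open>H\<close> edgeless on at most \<open>n\<close> vertices), and then the value is \<open>0\<close>.\<close>

definition turan :: "nat \<Rightarrow> 'a graph \<Rightarrow> nat" where
  "turan n H = Sup (turan_edge_counts n H)"

lemma finite_turan_edge_counts: "finite (turan_edge_counts n H)"
proof (rule finite_subset)
  show "turan_edge_counts n H \<subseteq> {..2 ^ n}"
  proof
    fix k assume "k \<in> turan_edge_counts n H"
    then obtain G :: "nat graph"
      where G: "simple_graph G" "card (verts G) = n" "k = card (edges G)"
      by (auto simp: turan_edge_counts_def)
    have "edges G \<subseteq> Pow (verts G)" and fin: "finite (verts G)"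
      using G(1) by (auto simp: simple_graph_def)
    hence "card (edges G) \<le> card (Pow (verts G))"
      by (intro card_mono) auto
    thus "k \<in> {..2 ^ n}"
      using G fin by (simp add: card_Pow)
  qed
qed simp

lemma turan_eq_Max:
  "turan_edge_counts n H \<noteq> {} \<Longrightarrow> turan n H = Max (turan_edge_counts n H)"
  by (simp add: turan_def Sup_nat_def)

lemma isomorphic_trans:
  "isomorphic G G' \<Longrightarrow> isomorphic G' G'' \<Longrightarrow> isomorphic G G''"
  unfolding isomorphic_def
proof (elim exE conjE)
  fix f g
  assume "bij_betw f (verts G) (verts G')" "edges G' = (\<lambda>e. f ` e) ` edges G"
    "bij_betw g (verts G') (verts G'')" "edges G'' = (\<lambda>e. g ` e) ` edges G'"
  thus "\<exists>h. bij_betw h (verts G) (verts G'') \<and> edges G'' = (\<lambda>e. h ` e) ` edges G"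
    by (intro exI[of _ "g \<circ> f"]) (auto intro: bij_betw_trans simp: image_image image_comp)
qed

lemma image_graph:
  assumes "simple_graph S" and inj: "inj_on f (verts S)"
  defines "S' \<equiv> (f ` verts S, (\<lambda>e. f ` e) ` edges S)"
  shows "simple_graph S'" and "isomorphic S S'"
proof -
  have "card (f ` e) = 2 \<and> f ` e \<subseteq> f ` verts S" if "e \<in> edges S" for e
  proof -
    have e: "e \<subseteq> verts S" "card e = 2"
      using assms(1) that by (auto simp: simple_graph_def)
    show ?thesis
      using e card_image[OF inj_on_subset[OF inj e(1)]] by auto
  qed
  thus "simple_graph S'"
    using assms(1) by (auto simp: simple_graph_def S'_def)
  show "isomorphic S S'"
    using inj by (auto simp: isomorphic_def S'_def bij_betw_def)
qed

lemma card_edges_le_turan: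
  fixes G :: "'b graph"
  assumes G: "simple_graph G" "card (verts G) = n" "\<not> contains_copy G H"
  shows "card (edges G) \<le> turan n H"
proof -
  have fin: "finite (verts G)" and sub: "\<And>e. e \<in> edges G \<Longrightarrow> e \<subseteq> verts G"
    using G(1) by (auto simp: simple_graph_def)
  obtain f :: "'b \<Rightarrow> nat" where f: "inj_on f (verts G)"
    using finite_imp_inj_to_nat_seg[OF fin] by blast
  define g where "g = inv_into (verts G) f"
  define G' where "G' = (f ` verts G, (\<lambda>e. f ` e) ` edges G)"
  have G': "simple_graph G'"
    unfolding G'_def using image_graph(1)[OF G(1) f] .
  have gf: "g ` f ` e = e" if "e \<subseteq> verts G" for e
    using that f by (simp add: g_def inv_into_image_cancel)
  have "\<not> contains_copy G' H"
  proof
    assume "contains_copy G' H"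
    then obtain S where S: "subgraph S G'" "isomorphic H S"
      by (auto simp: contains_copy_def)
    hence simS: "simple_graph S" and vS: "verts S \<subseteq> f ` verts G"
      and eS: "edges S \<subseteq> (\<lambda>e. f ` e) ` edges G"
      by (auto simp: subgraph_def G'_def)
    have injg: "inj_on g (verts S)"
      unfolding g_def by (rule inj_on_inv_into[OF vS])
    define T where "T = (g ` verts S, (\<lambda>e. g ` e) ` edges S)"
    have "simple_graph T" "isomorphic S T"
      unfolding T_def using image_graph[OF simS injg] by auto
    moreover have "verts T \<subseteq> verts G"
      using image_mono[OF vS, of g] gf[of "verts G"] by (simp add: T_def)
    moreover have "edges T \<subseteq> edges G"
    proof
      fix e assume "e \<in> edges T"
      then obtain d where "d \<in> edges G" "e = g ` f ` d"
        using eS by (auto simp: T_def)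
      thus "e \<in> edges G"
        using gf[OF sub] by simp
    qed
    ultimately have "contains_copy G H"
      unfolding contains_copy_def subgraph_def using isomorphic_trans[OF S(2)] by blast
    thus False using G(3) by simp
  qed
  moreover have "card (verts G') = n"
    using G(2) f by (simp add: G'_def card_image)
  moreover have "inj_on (\<lambda>e. f ` e) (edges G)"
    by (rule inj_onI) (metis gf sub)
  hence "card (edges G') = card (edges G)"
    by (simp add: G'_def card_image)
  ultimately have "card (edges G) \<in> turan_edge_counts n H"
    using G' unfolding turan_edge_counts_def by (intro CollectI exI[of _ G']) simp
  thus ?thesis
    unfolding turan_def by (intro cSup_upper bdd_above_finite finite_turan_edge_counts)
qed

end

theory Submission
  imports Defs
begin

text \<open>Dependent random choice is applied twice to a graph with at least
  \<open>n powr (2 - 1/(8 r))\<close> edges. The common neighbourhood of a random \<open>4 r\<close>-tuple, after a few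
  deletions, is a set \<open>U\<close> of size at least \<open>sqrt n\<close> in which every \<open>q\<close>-tuple, \<open>q\<close> about
  \<open>7 r / 2\<close>, has at least \<open>h\<close> common neighbours. Let \<open>W\<close> be the common neighbourhood of a random
  \<open>(q - r)\<close>-tuple \<open>T\<close> of \<open>U\<close>. Some choice of \<open>T\<close> gives every \<open>r\<close>-tuple of \<open>W\<close> at least \<open>h\<close>
  common neighbours in \<open>U\<close>; and an \<open>r\<close>-tuple of \<open>U\<close> together with \<open>T\<close> is a \<open>q\<close>-tuple, so it has
  at least \<open>h\<close> common neighbours in \<open>W\<close>. An \<open>r\<close>-degenerate bipartite graph then embeds greedily
  between \<open>U\<close> and \<open>W\<close>. These sets may overlap: injectivity comes from avoiding the at most
  \<open>h - 1\<close> vertices already used.\<close>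

section \<open>Common neighbourhoods and tuples\<close>

definition common_nbrs :: "'a graph \<Rightarrow> 'a set \<Rightarrow> 'a set" where
  "common_nbrs G X = {v \<in> verts G. \<forall>x\<in>X. {x, v} \<in> edges G}"

text \<open>Lists with repetition model sampling with replacement: counts are exact powers, and a
  smaller nonempty set still becomes a tuple after padding.\<close>

definition tuples :: "'a set \<Rightarrow> nat \<Rightarrow> 'a list set" where
  "tuples A k = {xs. set xs \<subseteq> A \<and> length xs = k}"

lemma finite_tuples: "finite A \<Longrightarrow> finite (tuples A k)"
  unfolding tuples_def by (rule finite_lists_length_eq)

lemma card_tuples: "finite A \<Longrightarrow> card (tuples A k) = card A ^ k"
  unfolding tuples_def by (rule card_lists_length_eq)

lemma finite_common_nbrs: "simple_graph G \<Longrightarrow> finite (common_nbrs G X)"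
  by (simp add: common_nbrs_def simple_graph_def)

lemma common_nbrs_subset: "common_nbrs G X \<subseteq> verts G"
  by (auto simp: common_nbrs_def)

text \<open>Both inclusions say that every vertex of \<open>X\<close> is adjacent to every vertex of
  \<open>Y\<close>. This is what allows double counting: the tuples whose common neighbourhood
  contains \<open>S\<close> are the tuples inside that of \<open>S\<close>.\<close>

lemma common_nbrs_swap:
  assumes "X \<subseteq> verts G" "Y \<subseteq> verts G"
  shows "X \<subseteq> common_nbrs G Y \<longleftrightarrow> Y \<subseteq> common_nbrs G X"
proof -
  have "X \<subseteq> common_nbrs G Y \<longleftrightarrow> (\<forall>x\<in>X. \<forall>y\<in>Y. {y, x} \<in> edges G)"
    using assms(1) by (auto simp: common_nbrs_def)
  also have "\<dots> \<longleftrightarrow> (\<forall>y\<in>Y. \<forall>x\<in>X. {y, x} \<in> edges G)"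
    by blast
  also have "\<dots> \<longleftrightarrow> Y \<subseteq> common_nbrs G X"
    using assms(2) by (auto simp: common_nbrs_def insert_commute)
  finally show ?thesis .
qed

lemma set_as_tuple:
  assumes "finite X" "X \<noteq> {}" "card X \<le> k"
  obtains xs where "set xs = X" "length xs = k"
proof -
  obtain ys where ys: "set ys = X" "length ys = card X"
    using assms(1) finite_distinct_list distinct_card by metis
  have "set (ys @ replicate (k - card X) (hd ys)) = X"
    using ys assms(2) by (cases ys) auto
  moreover have "length (ys @ replicate (k - card X) (hd ys)) = k"
    using ys assms(3) by simp
  ultimately show ?thesis using that by blast
qed

section \<open>Degree sum and power mean\<close>

text \<open>Handshake lemma: neighbours of \<open>v\<close> correspond to edges at \<open>v\<close>,
  and each edge is counted at its two ends.\<close>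

lemma sum_card_common_nbrs:
  assumes "simple_graph G"
  shows "(\<Sum>v\<in>verts G. card (common_nbrs G {v})) = 2 * card (edges G)"
proof -
  have fin: "finite (verts G)" and sub: "\<And>e. e \<in> edges G \<Longrightarrow> e \<subseteq> verts G \<and> card e = 2"
    using assms by (auto simp: simple_graph_def)
  have finE: "finite (edges G)"
    using fin sub by (auto intro: finite_subset[of _ "Pow (verts G)"])
  have "card (common_nbrs G {v}) = card {e \<in> edges G. v \<in> e}" if "v \<in> verts G" for v
  proof -
    have "inj_on (\<lambda>u. {v, u}) (common_nbrs G {v})"
      by (auto simp: inj_on_def doubleton_eq_iff)
    moreover have "(\<lambda>u. {v, u}) ` common_nbrs G {v} = {e \<in> edges G. v \<in> e}"
    proof (intro equalityI subsetI)
      fix e assume e: "e \<in> {e \<in> edges G. v \<in> e}"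
      then obtain x y where xy: "e = {x, y}" "x \<noteq> y"
        using sub[of e] by (auto simp: card_2_iff)
      then obtain u where "e = {v, u}"
        using e by auto
      thus "e \<in> (\<lambda>u. {v, u}) ` common_nbrs G {v}"
        using e sub[of e] by (auto simp: common_nbrs_def)
    qed (auto simp: common_nbrs_def)
    ultimately show ?thesis
      by (metis card_image)
  qed
  hence "(\<Sum>v\<in>verts G. card (common_nbrs G {v})) = (\<Sum>v\<in>verts G. card {e \<in> edges G. v \<in> e})"
    by simp
  also have "\<dots> = 2 * card (edges G)"
  proof (rule sum_multicount[OF fin finE], rule ballI)
    fix e assume "e \<in> edges G"
    hence "{v \<in> verts G. v \<in> e} = e" "card e = 2"
      using sub[of e] by auto
    thus "card {v \<in> verts G. v \<in> e} = 2" by simp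
  qed
  finally show ?thesis .
qed

text \<open>Bernoulli's inequality at \<open>f x / a\<close> bounds \<open>f x ^ t\<close> from
  below by the tangent at the mean \<open>a\<close>; the linear terms sum to zero.\<close>

lemma power_mean_le:
  fixes f :: "'a \<Rightarrow> real"
  assumes "finite A" "A \<noteq> {}" "\<And>x. x \<in> A \<Longrightarrow> f x \<ge> 0"
  shows "real (card A) * (sum f A / card A) ^ t \<le> (\<Sum>x\<in>A. f x ^ t)"
proof -
  define a where "a = sum f A / card A"
  have cA: "real (card A) > 0"
    using assms by (simp add: card_gt_0_iff)
  have "a \<ge> 0"
    unfolding a_def by (simp add: assms sum_nonneg)
  show ?thesis
  proof (cases "a = 0")
    case True
    have "sum f A = 0"
      using True cA by (simp add: a_def)
    hence "\<forall>x\<in>A. f x = 0"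
      using assms by (simp add: sum_nonneg_eq_0_iff)
    thus ?thesis by simp
  next
    case False
    hence a: "a > 0" using \<open>a \<ge> 0\<close> by simp
    have "a ^ t * (1 + t * (f x / a - 1)) \<le> f x ^ t" if "x \<in> A" for x
    proof -
      have "1 + t * (f x / a - 1) \<le> (1 + (f x / a - 1)) ^ t"
        using assms(3)[OF that] a by (intro Bernoulli_inequality) simp
      hence "a ^ t * (1 + t * (f x / a - 1)) \<le> a ^ t * (f x / a) ^ t"
        using a by (intro mult_left_mono) auto
      thus ?thesis
        using a by (simp add: power_divide)
    qed
    hence "(\<Sum>x\<in>A. a ^ t * (1 + t * (f x / a - 1))) \<le> (\<Sum>x\<in>A. f x ^ t)"
      by (intro sum_mono)
    moreover have "(\<Sum>x\<in>A. a ^ t * (1 + t * (f x / a - 1))) =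
        a ^ t * (card A + t * (sum f A / a - card A))"
      by (simp add: sum.distrib sum_subtractf flip: sum_distrib_left sum_divide_distrib)
    moreover have "sum f A / a = card A"
      using a cA by (simp add: a_def field_simps)
    ultimately show ?thesis
      by (simp add: a_def mult.commute)
  qed
qed

section \<open>Dependent random choice\<close>

text \<open>Dependent random choice: \<open>N(T)\<close> is averaged over all \<open>t\<close>-tuples \<open>T\<close>, and the head of
  every \<open>q\<close>-tuple in \<open>N(T)\<close> with fewer than \<open>h\<close> common neighbours is deleted from it.\<close>

lemma dependent_random_choice:
  assumes G: "simple_graph G" and n: "card (verts G) = n" "n > 0" and "q > 0"
  obtains U where "U \<subseteq> verts G"
    "\<And>xs. xs \<in> tuples U q \<Longrightarrow> h \<le> card (common_nbrs G (set xs))"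
    "real n * (2 * card (edges G) / n) ^ t \<le> real (n ^ t * card U + n ^ q * h ^ t)"
proof -
  let ?V = "verts G" and ?N = "common_nbrs G"
  have fin: "finite ?V"
    using G by (simp add: simple_graph_def)
  define bad where "bad = {S \<in> tuples ?V q. card (?N (set S)) < h}"
  define badin where "badin T = {S \<in> bad. set S \<subseteq> ?N (set T)}" for T
  have finbad: "finite bad"
    unfolding bad_def using finite_tuples[OF fin] by simp
  hence finbadin: "finite (badin T)" for T
    by (simp add: badin_def)
  have card_bad: "card bad \<le> n ^ q"
    using card_mono[OF finite_tuples[OF fin, of q], of bad] card_tuples[OF fin, of q] n
    by (auto simp: bad_def)
  have V0: "?V \<noteq> {}"
    using n by auto
  let ?T = "tuples ?V t"
  have finT: "finite ?T"
    by (rule finite_tuples[OF fin])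
  \<comment> \<open>Double counting of pairs \<open>(T, v)\<close>: for fixed \<open>v\<close>, the
    suitable \<open>T\<close> are the \<open>t\<close>-tuples of neighbours of
    \<open>v\<close>.\<close>
  have sumN: "(\<Sum>T\<in>?T. card (?N (set T))) = (\<Sum>v\<in>?V. card (?N {v}) ^ t)"
  proof -
    have "(\<Sum>T\<in>?T. card {v \<in> ?V. v \<in> ?N (set T)}) =
        (\<Sum>v\<in>?V. card {T \<in> ?T. v \<in> ?N (set T)})"
      using sum_multicount_gen[OF finT fin, of "\<lambda>T v. v \<in> ?N (set T)"] by auto
    moreover have "{v \<in> ?V. v \<in> ?N (set T)} = ?N (set T)" for T
      using common_nbrs_subset[of G "set T"] by blast
    moreover have "{T \<in> ?T. v \<in> ?N (set T)} = tuples (?N {v}) t" if "v \<in> ?V" for v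
      using that common_nbrs_swap[of "{v}" G] common_nbrs_subset[of G "{v}"]
      by (auto simp: tuples_def)
    ultimately show ?thesis
      by (simp add: card_tuples finite_common_nbrs[OF G])
  qed
  \<comment> \<open>A bad \<open>S\<close> matters only for \<open>T\<close> inside its own common
    neighbourhood, which has fewer than \<open>h\<close> vertices.\<close>
  have sumbad: "(\<Sum>T\<in>?T. card (badin T)) \<le> n ^ q * h ^ t"
  proof -
    have "(\<Sum>T\<in>?T. card (badin T)) = (\<Sum>S\<in>bad. card {T \<in> ?T. set S \<subseteq> ?N (set T)})"
      unfolding badin_def
      using sum_multicount_gen[OF finT finbad, of "\<lambda>T S. set S \<subseteq> ?N (set T)"] by auto
    also have "\<dots> \<le> (\<Sum>S\<in>bad. h ^ t)"
    proof (rule sum_mono)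
      fix S assume S: "S \<in> bad"
      hence "{T \<in> ?T. set S \<subseteq> ?N (set T)} = tuples (?N (set S)) t"
        using common_nbrs_swap[of "set S" G] common_nbrs_subset[of G "set S"]
        by (auto simp: tuples_def bad_def)
      thus "card {T \<in> ?T. set S \<subseteq> ?N (set T)} \<le> h ^ t"
        using S by (auto simp: card_tuples finite_common_nbrs[OF G] bad_def intro: power_mono)
    qed
    also have "\<dots> \<le> n ^ q * h ^ t"
      using card_bad by simp
    finally show ?thesis .
  qed
  \<comment> \<open>Integer-valued, since the difference may be negative. A \<open>T\<close>
    maximising it does at least as well as the average, which replaces the expectation.\<close>
  define F where "F T = int (card (?N (set T))) - int (card (badin T))" for T
  have T0: "?T \<noteq> {}"
    using card_tuples[OF fin, of t] n by auto
  define K where "K = Max (F ` ?T)"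
  have "K \<in> F ` ?T"
    unfolding K_def using T0 finT by (intro Max_in) auto
  then obtain T where T: "T \<in> ?T" "F T = K"
    by auto
  have "(\<Sum>T\<in>?T. F T) \<le> int (card ?T) * K"
    unfolding K_def using finT by (intro sum_bounded_above) auto
  hence sum_le: "int (\<Sum>v\<in>?V. card (?N {v}) ^ t) - int (\<Sum>T\<in>?T. card (badin T)) \<le> int (n ^ t) * F T"
    unfolding F_def sum_subtractf using sumN T(2) n F_def card_tuples[OF fin, of t]
    by (simp flip: sumN)
  define U where "U = ?N (set T) - hd ` badin T"
  have cardU: "F T \<le> card U"
  proof -
    have "card (?N (set T)) - card (hd ` badin T) \<le> card U"
      unfolding U_def by (intro diff_card_le_card_Diff finite_imageI finbadin)
    moreover have "card (hd ` badin T) \<le> card (badin T)"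
      by (rule card_image_le[OF finbadin])
    ultimately show ?thesis
      by (simp add: F_def)
  qed
  have UV: "U \<subseteq> ?V"
    using common_nbrs_subset[of G "set T"] by (auto simp: U_def)
  show ?thesis
  proof (rule that[OF UV])
    fix xs assume xs: "xs \<in> tuples U q"
    \<comment> \<open>\<open>q > 0\<close> gives \<open>xs\<close> a head in \<open>U\<close>; if
      \<open>xs\<close> were in \<open>badin T\<close>, that head would have been deleted.\<close>
    have "hd xs \<in> U" "set xs \<subseteq> ?N (set T)"
      using xs \<open>q > 0\<close> by (cases xs; auto simp: tuples_def U_def)+
    hence "xs \<notin> badin T"
      by (auto simp: U_def)
    thus "h \<le> card (?N (set xs))"
      using xs UV \<open>set xs \<subseteq> ?N (set T)\<close> by (auto simp: badin_def bad_def tuples_def)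
  next
    have "int (n ^ t) * F T \<le> int (n ^ t) * int (card U)"
      using cardU by (intro mult_left_mono) auto
    hence "int (\<Sum>v\<in>?V. card (?N {v}) ^ t) \<le> int (n ^ t * card U + n ^ q * h ^ t)"
      using sum_le of_nat_mono[OF sumbad, where 'a = int]
      unfolding of_nat_add of_nat_mult by linarith
    hence "real (\<Sum>v\<in>?V. card (?N {v}) ^ t) \<le> real (n ^ t * card U + n ^ q * h ^ t)"
      by linarith
    moreover have "real n * (2 * card (edges G) / n) ^ t \<le> real (\<Sum>v\<in>?V. card (?N {v}) ^ t)"
      using power_mean_le[OF fin V0, of "\<lambda>v. real (card (?N {v}))" t] n
        arg_cong[OF sum_card_common_nbrs[OF G], of real]
      by simp
    ultimately show "real n * (2 * card (edges G) / n) ^ t \<le> real (n ^ t * card U + n ^ q * h ^ t)"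
      by simp
  qed
qed

text \<open>Union bound over \<open>s\<close>-tuples \<open>T\<close> of \<open>U\<close>: each of
  the at most \<open>n ^ r\<close> bad \<open>r\<close>-tuples lies in the common neighbourhood of
  at most \<open>h ^ s\<close> of them, so by \<open>less\<close> some \<open>T\<close> avoids all
  bad ones. Its common neighbourhood is \<open>W\<close>.\<close>

lemma second_random_choice:
  assumes G: "simple_graph G" and n: "card (verts G) = n" and U: "U \<subseteq> verts G"
    and good: "\<And>xs. xs \<in> tuples U (r + s) \<Longrightarrow> h \<le> card (common_nbrs G (set xs))"
    and less: "n ^ r * h ^ s < card U ^ s"
  obtains W where "W \<subseteq> verts G"
    "\<And>xs. xs \<in> tuples U r \<Longrightarrow> h \<le> card (common_nbrs G (set xs) \<inter> W)"
    "\<And>xs. xs \<in> tuples W r \<Longrightarrow> h \<le> card (common_nbrs G (set xs) \<inter> U)"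
proof -
  let ?V = "verts G" and ?N = "common_nbrs G" and ?T = "tuples U s"
  have fin: "finite ?V"
    using G by (simp add: simple_graph_def)
  have finU: "finite U"
    using U fin finite_subset by blast
  define bad where "bad = {S \<in> tuples ?V r. card (?N (set S) \<inter> U) < h}"
  have finbad: "finite bad"
    unfolding bad_def using finite_tuples[OF fin] by simp
  have card_bad: "card bad \<le> n ^ r"
    using card_mono[OF finite_tuples[OF fin, of r], of bad] card_tuples[OF fin, of r] n
    by (auto simp: bad_def)
  have "\<exists>T\<in>?T. \<forall>S\<in>bad. \<not> set S \<subseteq> ?N (set T)"
  proof (rule ccontr)
    assume "\<not> ?thesis"
    hence "?T \<subseteq> (\<Union>S\<in>bad. {T \<in> ?T. set S \<subseteq> ?N (set T)})"
      by blast
    also have "\<dots> \<subseteq> (\<Union>S\<in>bad. tuples (?N (set S) \<inter> U) s)"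
    proof (rule UN_mono[OF subset_refl])
      fix S assume "S \<in> bad"
      thus "{T \<in> ?T. set S \<subseteq> ?N (set T)} \<subseteq> tuples (?N (set S) \<inter> U) s"
        using common_nbrs_swap[of "set S" G] U by (auto simp: tuples_def bad_def)
    qed
    finally have "card ?T \<le> card (\<Union>S\<in>bad. tuples (?N (set S) \<inter> U) s)"
      using finbad finU by (intro card_mono) (auto intro: finite_tuples)
    also have "\<dots> \<le> (\<Sum>S\<in>bad. card (tuples (?N (set S) \<inter> U) s))"
      by (rule card_UN_le[OF finbad])
    also have "\<dots> \<le> (\<Sum>S\<in>bad. h ^ s)"
      using finU by (intro sum_mono) (auto simp: card_tuples bad_def intro: power_mono)
    also have "\<dots> \<le> n ^ r * h ^ s"
      using card_bad by simp
    finally show False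
      using less finU by (simp add: card_tuples)
  qed
  then obtain T where T: "T \<in> ?T" "\<And>S. S \<in> bad \<Longrightarrow> \<not> set S \<subseteq> ?N (set T)"
    by blast
  show ?thesis
  proof (rule that[of "?N (set T)"])
    fix xs assume "xs \<in> tuples U r"
    hence "h \<le> card (?N (set (xs @ T)))"
      using T(1) by (intro good) (auto simp: tuples_def)
    moreover have "?N (set (xs @ T)) = ?N (set xs) \<inter> ?N (set T)"
      by (auto simp: common_nbrs_def)
    ultimately show "h \<le> card (?N (set xs) \<inter> ?N (set T))"
      by simp
  next
    fix xs assume xs: "xs \<in> tuples (?N (set T)) r"
    hence "xs \<in> tuples ?V r" "xs \<notin> bad"
      using T(2)[of xs] common_nbrs_subset[of G "set T"] by (auto simp: tuples_def)
    thus "h \<le> card (?N (set xs) \<inter> U)"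
      by (simp add: bad_def)
  qed (rule common_nbrs_subset)
qed

section \<open>Greedy embedding of degenerate graphs\<close>

lemma degenerate_subgraph:
  "degenerate r H \<Longrightarrow> subgraph S H \<Longrightarrow> degenerate r S"
  unfolding degenerate_def subgraph_def by (meson order_trans)

text \<open>Induction, deleting a vertex \<open>v\<close> of degree at most \<open>r\<close>: the
  images of its neighbours lie in the opposite class and have at least \<open>h\<close> common
  neighbours in the class of \<open>v\<close>, not all of them occupied. Indexing the classes by
  \<open>bool\<close> treats both sides at once.\<close>

lemma degenerate_embedding:
  fixes H :: "'a graph" and G :: "'b graph" and col :: "'a \<Rightarrow> bool" and U :: "bool \<Rightarrow> 'b set"
  assumes "simple_graph H" "degenerate r H" "card (verts H) \<le> h"
    and col: "\<And>x y. {x, y} \<in> edges H \<Longrightarrow> col x \<noteq> col y"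
    and G: "simple_graph G"
    and good: "\<And>b X. X \<subseteq> U (\<not> b) \<Longrightarrow> finite X \<Longrightarrow> card X \<le> r \<Longrightarrow> h \<le> card (common_nbrs G X \<inter> U b)"
  shows "\<exists>f. inj_on f (verts H) \<and> (\<forall>x\<in>verts H. f x \<in> verts G \<inter> U (col x)) \<and>
    (\<forall>x y. {x, y} \<in> edges H \<longrightarrow> {f x, f y} \<in> edges G)"
  using assms(1-4)
proof (induction "card (verts H)" arbitrary: H)
  case 0
  hence "verts H = {}"
    by (auto simp: simple_graph_def)
  moreover from this have "{x, y} \<notin> edges H" for x y
    using "0.prems"(1) by (auto simp: simple_graph_def)
  ultimately show ?case by auto
next
  case (Suc k)
  have finH: "finite (verts H)"
    and eH: "\<And>e. e \<in> edges H \<Longrightarrow> e \<subseteq> verts H \<and> card e = 2"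
    using Suc.prems(1) by (auto simp: simple_graph_def)
  have finE: "finite (edges H)"
    using finH eH by (auto intro: finite_subset[of _ "Pow (verts H)"])
  have "subgraph H H" "verts H \<noteq> {}"
    using Suc.prems(1) Suc.hyps(2) by (auto simp: subgraph_def)
  then obtain v where v: "v \<in> verts H" "degree H v \<le> r"
    using Suc.prems(2) unfolding degenerate_def by blast
  define H' where "H' = (verts H - {v}, {e \<in> edges H. v \<notin> e})"
  have sub: "subgraph H' H"
    using finH eH by (auto simp: H'_def subgraph_def simple_graph_def)
  have kH': "k = card (verts H')"
    using Suc.hyps(2) v(1) finH by (simp add: H'_def)
  have "\<exists>f. inj_on f (verts H') \<and> (\<forall>x\<in>verts H'. f x \<in> verts G \<inter> U (col x)) \<and>
    (\<forall>x y. {x, y} \<in> edges H' \<longrightarrow> {f x, f y} \<in> edges G)"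
  proof (rule Suc.hyps(1)[OF kH'])
    show "simple_graph H'" "degenerate r H'"
      using sub degenerate_subgraph[OF Suc.prems(2)] by (auto simp: subgraph_def)
    show "card (verts H') \<le> h"
      using kH' Suc.hyps(2) Suc.prems(3) by simp
    show "col x \<noteq> col y" if "{x, y} \<in> edges H'" for x y
      using that by (intro Suc.prems(4)) (simp add: H'_def)
  qed
  then obtain f where f: "inj_on f (verts H')"
    "\<And>x. x \<in> verts H' \<Longrightarrow> f x \<in> verts G \<inter> U (col x)"
    "\<And>x y. {x, y} \<in> edges H' \<Longrightarrow> {f x, f y} \<in> edges G"
    by blast
  define N where "N = {x. {v, x} \<in> edges H}"
  have NH: "N \<subseteq> verts H'"
  proof
    fix x assume "x \<in> N"
    hence "{v, x} \<subseteq> verts H" "card {v, x} = 2"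
      using eH by (auto simp: N_def)
    thus "x \<in> verts H'" by (auto simp: H'_def)
  qed
  hence finN: "finite N"
    using finH by (auto simp: H'_def intro: finite_subset)
  have "card N = card ((\<lambda>x. {v, x}) ` N)"
    by (rule card_image[symmetric]) (auto simp: inj_on_def doubleton_eq_iff)
  also have "\<dots> \<le> degree H v"
    unfolding degree_def using finE by (intro card_mono) (auto simp: N_def)
  finally have cardN: "card N \<le> r"
    using v(2) by simp
  have "f ` N \<subseteq> U (\<not> col v)"
  proof
    fix y assume "y \<in> f ` N"
    then obtain x where x: "x \<in> N" "y = f x" by auto
    hence "col v \<noteq> col x"
      using Suc.prems(4) by (auto simp: N_def)
    hence "(\<not> col v) = col x" by auto
    thus "y \<in> U (\<not> col v)"
      using f(2)[of x] x NH by auto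
  qed
  hence "h \<le> card (common_nbrs G (f ` N) \<inter> U (col v))"
    using finN cardN card_image_le[OF finN, of f] by (intro good) auto
  \<comment> \<open>Strict because \<open>v\<close> itself is not yet placed.\<close>
  moreover have "card (f ` verts H') < h"
    using card_image[OF f(1)] kH' Suc.hyps(2) Suc.prems(3) by simp
  ultimately have "\<not> common_nbrs G (f ` N) \<inter> U (col v) \<subseteq> f ` verts H'"
    using card_mono[of "f ` verts H'" "common_nbrs G (f ` N) \<inter> U (col v)"] finH
    by (auto simp: H'_def)
  then obtain w where w: "w \<in> common_nbrs G (f ` N)" "w \<in> U (col v)" "w \<notin> f ` verts H'"
    by blast
  define g where "g = f(v := w)"
  have gf: "g x = f x" if "x \<in> verts H'" for x
    using that by (auto simp: g_def H'_def)
  have vH: "verts H = insert v (verts H')" "v \<notin> verts H'"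
    using v(1) by (auto simp: H'_def)
  have gv: "g v = w" by (simp add: g_def)
  have nbr: "{w, f x} \<in> edges G" if "{v, x} \<in> edges H" for x
    using w(1) that by (auto simp: common_nbrs_def N_def insert_commute)
  have "inj_on g (verts H)"
  proof -
    have "inj_on g (verts H')"
      using f(1) gf by (simp cong: inj_on_cong)
    moreover have "g ` (verts H' - {v}) = f ` verts H'"
      using gf vH(2) by (auto simp: image_iff)
    ultimately show ?thesis
      using w(3) gv by (simp add: vH(1))
  qed
  moreover have "\<forall>x\<in>verts H. g x \<in> verts G \<inter> U (col x)"
    unfolding vH using gf f(2) gv w(1,2) by (auto simp: common_nbrs_def)
  moreover have "{g x, g y} \<in> edges G" if xy: "{x, y} \<in> edges H" for x y
  proof -
    have "{x, y} \<subseteq> verts H" "x \<noteq> y"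
      using eH[OF xy] by auto
    consider "x = v" | "y = v" | "x \<noteq> v" "y \<noteq> v" by blast
    thus ?thesis
    proof cases
      case 1
      thus ?thesis using nbr[of y] xy gv \<open>x \<noteq> y\<close> by (simp add: g_def)
    next
      case 2
      thus ?thesis using nbr[of x] xy gv \<open>x \<noteq> y\<close> by (simp add: g_def insert_commute)
    next
      case 3
      thus ?thesis using f(3)[of x y] xy by (simp add: g_def H'_def)
    qed
  qed
  ultimately show ?case by blast
qed

lemma embedding_imp_contains_copy:
  assumes H: "simple_graph H" and f: "inj_on f (verts H)" "f ` verts H \<subseteq> verts G"
    and e: "\<And>x y. {x, y} \<in> edges H \<Longrightarrow> {f x, f y} \<in> edges G"
  shows "contains_copy G H"
proof -
  let ?S = "(f ` verts H, (\<lambda>e. f ` e) ` edges H)"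
  have "f ` d \<in> edges G" if d: "d \<in> edges H" for d
  proof -
    obtain x y where "d = {x, y}"
      using H d by (auto simp: simple_graph_def card_2_iff)
    thus ?thesis
      using e d by simp
  qed
  hence "subgraph ?S G"
    using image_graph(1)[OF H f(1)] f(2) by (auto simp: subgraph_def)
  thus ?thesis
    using image_graph(2)[OF H f(1)] by (auto simp: contains_copy_def)
qed

section \<open>Parameters for a dense graph\<close>

lemma contains_copy_of_dense:
  fixes G :: "'b graph" and H :: "'a graph"
  assumes r: "r > 0" and H: "simple_graph H" "degenerate r H" "bipartite H"
    and h: "card (verts H) = h" "h ^ 10 < n"
    and G: "simple_graph G" "card (verts G) = n"
    and dense: "real n powr (2 - 1 / (8 * real r)) \<le> card (edges G)"
  shows "contains_copy G H"
proof (cases "h = 0")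
  case True
  hence "verts H = {}"
    using H(1) h by (simp add: simple_graph_def)
  moreover from this have "{x, y} \<notin> edges H" for x y
    using H(1) by (auto simp: simple_graph_def)
  ultimately show ?thesis
    using H(1) by (intro embedding_imp_contains_copy) auto
next
  case False
  have n: "n > 0" using h by simp
  \<comment> \<open>\<open>5 r \<le> 2 s\<close> makes the second random choice succeed, \<open>10 s \<le> 26 r + 5\<close> the first.\<close>
  define s where "s = (5 * r + 1) div 2"
  have s: "5 * r \<le> 2 * s" "2 * s \<le> 5 * r + 1" "s > 0"
    using r by (auto simp: s_def)
  obtain U where U: "U \<subseteq> verts G"
    "\<And>xs. xs \<in> tuples U (r + s) \<Longrightarrow> h \<le> card (common_nbrs G (set xs))"
    and dens: "real n * (2 * card (edges G) / n) ^ (4 * r)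
      \<le> real (n ^ (4 * r) * card U + n ^ (r + s) * h ^ (4 * r))"
    using dependent_random_choice[OF G n, of "r + s" h "4 * r"] r by auto
  \<comment> \<open>The average degree is at least \<open>2 * n powr (1 - 1 / (8 * r))\<close>.
    Raised to the power \<open>4 * r\<close>, the deficit in the exponent becomes 1/2 and the factor
    2 becomes \<open>16 ^ r\<close>.\<close>
  have main: "16 ^ r * (real n ^ (4 * r) * sqrt n) \<le> real n * (2 * card (edges G) / n) ^ (4 * r)"
  proof -
    have "2 * real n powr (1 - 1 / (8 * real r)) \<le> 2 * card (edges G) / n"
    proof -
      have "real n powr (2 - 1 / (8 * real r)) = n * real n powr (1 - 1 / (8 * real r))"
        using n powr_add[of "real n" 1 "1 - 1 / (8 * real r)"] by simp
      thus ?thesis using dense n by (simp add: field_simps)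
    qed
    hence "(2 * real n powr (1 - 1 / (8 * real r))) ^ (4 * r) \<le> (2 * card (edges G) / n) ^ (4 * r)"
      by (intro power_mono) auto
    moreover have "(2 * real n powr (1 - 1 / (8 * real r))) ^ (4 * r)
        = 16 ^ r * real n powr (4 * real r - 1 / 2)"
    proof -
      have "(real n powr (1 - 1 / (8 * real r))) ^ (4 * r) = real n powr (4 * real r - 1 / 2)"
      proof -
        have "(1 - 1 / (8 * real r)) * real (4 * r) = 4 * real r - 1 / 2"
          using r by (simp add: field_simps)
        thus ?thesis
          using n by (simp add: powr_powr flip: powr_realpow)
      qed
      thus ?thesis by (simp add: power_mult_distrib power_mult)
    qed
    moreover have "n * real n powr (4 * real r - 1 / 2) = real n ^ (4 * r) * sqrt n"
    proof -
      have "n * real n powr (4 * real r - 1 / 2) = real n powr (1 + (4 * real r - 1 / 2))"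
        using n by (subst powr_add) simp
      also have "\<dots> = real n powr (real (4 * r) + 1 / 2)" by (simp add: add.commute)
      also have "\<dots> = real n ^ (4 * r) * sqrt n"
        using n by (subst powr_add) (simp add: powr_half_sqrt powr_realpow del: of_nat_mult)
      finally show ?thesis .
    qed
    ultimately have "16 ^ r * real n powr (4 * real r - 1 / 2) \<le> (2 * card (edges G) / n) ^ (4 * r)"
      and eq: "n * real n powr (4 * real r - 1 / 2) = real n ^ (4 * r) * sqrt n"
      by simp_all
    hence "n * (16 ^ r * real n powr (4 * real r - 1 / 2)) \<le> n * (2 * card (edges G) / n) ^ (4 * r)"
      by (intro mult_left_mono) auto
    thus ?thesis
      by (simp only: mult.left_commute[of "real n"] eq)
  qed
  \<comment> \<open>Tenth powers bring in \<open>h ^ 10 < n\<close> and leave integer exponents of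
    \<open>n\<close>; the rule compares powers \<open>Suc n\<close>, hence the 9.\<close>
  have bad: "real (n ^ (r + s) * h ^ (4 * r)) \<le> real n ^ (4 * r) * sqrt n"
  proof (rule power_le_imp_le_base[where n = 9])
    have "(n ^ (r + s) * h ^ (4 * r)) ^ 10 = n ^ (10 * (r + s)) * (h ^ 10) ^ (4 * r)"
      by (simp add: power_mult_distrib mult.commute flip: power_mult)
    also have "\<dots> \<le> n ^ (10 * (r + s)) * n ^ (4 * r)"
      using h(2) by (intro mult_left_mono power_mono) auto
    also have "\<dots> = n ^ (10 * (r + s) + 4 * r)"
      by (rule power_add[symmetric])
    also have "\<dots> \<le> n ^ (40 * r + 5)"
      using n s by (intro power_increasing) auto
    finally have "real ((n ^ (r + s) * h ^ (4 * r)) ^ 10) \<le> real (n ^ (40 * r + 5))"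
      by linarith
    also have "\<dots> = (real n ^ (4 * r) * sqrt n) ^ 10"
    proof -
      have "sqrt n ^ 10 = (sqrt n ^ 2) ^ 5"
        by (simp only: flip: power_mult) simp
      hence "sqrt n ^ 10 = real n ^ 5"
        by simp
      thus ?thesis
        by (simp add: power_mult_distrib power_add flip: power_mult)
    qed
    finally show "real (n ^ (r + s) * h ^ (4 * r)) ^ Suc 9 \<le> (real n ^ (4 * r) * sqrt n) ^ Suc 9"
      by simp
  qed simp
  \<comment> \<open>Since \<open>16 ^ r\<close> is at least 2, one copy of the main term absorbs the
    deleted tuples and another remains for \<open>U\<close>.\<close>
  have "real n ^ (4 * r) * sqrt n \<le> real n ^ (4 * r) * card U"
  proof -
    have "(2::real) \<le> 16 ^ r"
      using r power_increasing[of 1 r "16::real"] by simp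
    hence "2 * (real n ^ (4 * r) * sqrt n) \<le> 16 ^ r * (real n ^ (4 * r) * sqrt n)"
      by (intro mult_right_mono) auto
    thus ?thesis
      using main dens bad by simp
  qed
  hence "sqrt n \<le> card U"
    using n by simp
  hence "real n \<le> real (card U ^ 2)"
    using sqrt_le_D[of "real n" "real (card U)"] by simp
  hence cU: "n \<le> card U ^ 2"
    by linarith
  \<comment> \<open>Tenth powers again: the left side stays below \<open>n ^ (10 * r + s)\<close>,
    the right side is at least \<open>n ^ (5 * s)\<close>, and \<open>5 * r \<le> 2 * s\<close>
    compares the two.\<close>
  have less: "n ^ r * h ^ s < card U ^ s"
  proof (rule power_less_imp_less_base[where n = 10])
    have "(n ^ r * h ^ s) ^ 10 = n ^ (10 * r) * (h ^ 10) ^ s"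
      by (simp add: power_mult_distrib mult.commute flip: power_mult)
    also have "\<dots> < n ^ (10 * r) * n ^ s"
      using h(2) n s(3) by (intro mult_strict_left_mono power_strict_mono) auto
    also have "\<dots> = n ^ (10 * r + s)"
      by (simp add: power_add)
    also have "\<dots> \<le> n ^ (5 * s)"
      using n s by (intro power_increasing) auto
    also have "\<dots> \<le> (card U ^ 2) ^ (5 * s)"
      using cU by (rule power_mono) simp
    also have "\<dots> = (card U ^ s) ^ 10"
      by (simp add: mult.commute flip: power_mult)
    finally show "(n ^ r * h ^ s) ^ 10 < (card U ^ s) ^ 10" .
  qed simp
  obtain W where W: "W \<subseteq> verts G"
    "\<And>xs. xs \<in> tuples U r \<Longrightarrow> h \<le> card (common_nbrs G (set xs) \<inter> W)"
    "\<And>xs. xs \<in> tuples W r \<Longrightarrow> h \<le> card (common_nbrs G (set xs) \<inter> U)"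
    using second_random_choice[OF G U less] by metis
  have finV: "finite (verts G)"
    using G by (simp add: simple_graph_def)
  \<comment> \<open>From exact \<open>r\<close>-tuples to sets of at most \<open>r\<close> vertices:
    an empty \<open>X\<close> is first enlarged to a singleton of \<open>B\<close>, a nonempty one
    is padded; shrinking the set only enlarges the common neighbourhood.\<close>
  have extend: "h \<le> card (common_nbrs G X \<inter> C)"
    if B: "B \<noteq> {}" and good: "\<And>xs. xs \<in> tuples B r \<Longrightarrow> h \<le> card (common_nbrs G (set xs) \<inter> C)"
      and X: "X \<subseteq> B" "finite X" "card X \<le> r" for B C X
  proof -
    obtain Y where Y: "X \<subseteq> Y" "Y \<subseteq> B" "Y \<noteq> {}" "finite Y" "card Y \<le> r"
    proof (cases "X = {}")
      case True
      obtain b where "b \<in> B" using B by auto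
      thus ?thesis using that[of "{b}"] True r by simp
    qed (use X that in blast)
    obtain xs where "set xs = Y" "length xs = r"
      using set_as_tuple[OF Y(4,3,5)] .
    hence "h \<le> card (common_nbrs G Y \<inter> C)"
      using good[of xs] Y(2) by (simp add: tuples_def)
    also have "\<dots> \<le> card (common_nbrs G X \<inter> C)"
      using Y(1) finite_common_nbrs[OF G(1)]
      by (intro card_mono) (auto simp: common_nbrs_def)
    finally show ?thesis .
  qed
  have U0: "U \<noteq> {}"
    using cU n by auto
  \<comment> \<open>For the empty set, \<open>extend\<close> bounds the size of \<open>W\<close>
    itself below by \<open>h\<close>, which is positive here.\<close>
  have W0: "W \<noteq> {}"
    using extend[OF U0 W(2), of "{}"] False by auto
  obtain A B where AB: "A \<union> B = verts H" "A \<inter> B = {}"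
    "\<And>e. e \<in> edges H \<Longrightarrow> \<exists>a\<in>A. \<exists>b\<in>B. e = {a, b}"
    using H(3) by (auto simp: bipartite_def)
  define P where "P b = (if b then U else W)" for b
  have "\<exists>f. inj_on f (verts H) \<and> (\<forall>x\<in>verts H. f x \<in> verts G \<inter> P (x \<in> A)) \<and>
    (\<forall>x y. {x, y} \<in> edges H \<longrightarrow> {f x, f y} \<in> edges G)"
  proof (rule degenerate_embedding[OF H(1,2) _ _ G(1), where h = h])
    show "card (verts H) \<le> h"
      using h by simp
    show "(x \<in> A) \<noteq> (y \<in> A)" if xy: "{x, y} \<in> edges H" for x y
      using AB(2) AB(3)[OF xy] by (auto simp: doubleton_eq_iff)
    show "h \<le> card (common_nbrs G X \<inter> P b)"
      if "X \<subseteq> P (\<not> b)" "finite X" "card X \<le> r" for b X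
      using that extend[OF U0 W(2), of X] extend[OF W0 W(3), of X]
      by (cases b) (auto simp: P_def)
  qed
  thus ?thesis
    using embedding_imp_contains_copy[OF H(1)] by blast
qed

section \<open>The bound for the Turan number\<close>

theorem theorem7p5:
  fixes r h n :: nat and H :: "'a graph"
  assumes "r > 0"
    and "simple_graph H"
    and "degenerate r H"
    and "bipartite H"
    and "card (verts H) = h"
    and "n > h ^ 10"
  shows "real (turan n H) < real n powr (2 - 1 / (8 * real r))"
proof (cases "turan_edge_counts n H = {}")
  \<comment> \<open>Here the Turan number takes its default value 0, while \<open>n\<close> and
    hence the bound are positive.\<close>
  case True
  thus ?thesis
    using assms(6) by (simp add: turan_def Sup_nat_def)
next
  case False
  \<comment> \<open>The maximum is attained by an \<open>H\<close>-free graph; an edge count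
    reaching the bound would force a copy of \<open>H\<close>, so the inequality is strict.\<close>
  hence "turan n H \<in> turan_edge_counts n H"
    using turan_eq_Max Max_in finite_turan_edge_counts by metis
  then obtain G :: "nat graph" where G: "simple_graph G" "card (verts G) = n"
    "\<not> contains_copy G H" "turan n H = card (edges G)"
    by (auto simp: turan_edge_counts_def)
  thus ?thesis
    using contains_copy_of_dense[OF assms G(1,2)] by fastforce
qed

end
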